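(* Let $q$ be a prime and let $j$ be a positive integer. Then $q^j$ is product-admissible if and only if $j\geq 2q+4$.
   Context: For a multiset $\{x_1,\dots,x_n\}$ of positive integers define $T\{x_1,\dots,x_n\}=(x_1+\cdots+x_n,\,x_1x_2\cdots x_n,\,n)$. An ordered triple $(s,p,n)$ of positive integers is called admissible if there exist at least two different multisets $X$, $Y$ of $n$ positive integers with $T(X)=T(Y)=(s,p,n)$. A positive integer $p$ is product-admissible if there exist positive integers $s$ and $n$ such that $(s,p,n)$ is admissible. *)

theory Defs
  imports "HOL-Computational_Algebra.Primes" "HOL-Library.Multiset"
begin

definition T :: "nat multiset \<Rightarrow> nat \<times> nat \<times> nat" where
  "T X = (sum_mset X, prod_mset X, size X)"

definition admissible :: "nat \<Rightarrow> nat \<Rightarrow> nat \<Rightarrow> bool" where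
  "admissible s p n \<longleftrightarrow> s > 0 \<and> p > 0 \<and> n > 0 \<and>
     (\<exists>X Y. X \<noteq> Y \<and> (\<forall>x\<in>#X. x > 0) \<and> (\<forall>y\<in>#Y. y > 0) \<and>
            size X = n \<and> size Y = n \<and> T X = (s, p, n) \<and> T Y = (s, p, n))"

definition product_admissible :: "nat \<Rightarrow> bool" where
  "product_admissible p \<longleftrightarrow> p > 0 \<and> (\<exists>s n. s > 0 \<and> n > 0 \<and> admissible s p n)"

end

theory Submission
  imports Defs
begin

text \<open>
  Every factor of \<open>q ^ j\<close> is a power of \<open>q\<close>, so the question is about two distinct multisets
  \<open>A\<close>, \<open>B\<close> of exponents with equal size, equal sum \<open>j\<close> and equal sum of \<open>q ^ a\<close>. The generating
  polynomial of \<open>A\<close> minus that of \<open>B\<close> vanishes doubly at 1 and simply at \<open>q\<close>; the multiple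
  \<open>(x - 1)\<^sup>2 (x - q) = x\<^sup>3 - (q + 2) x\<^sup>2 + (2 q + 1) x - q\<close> gives the example for \<open>j = 2 q + 4\<close>.
  For the lower bound, cancel common exponents and shift so that 0 occurs in \<open>A\<close> but not in \<open>B\<close>.
  Then the multiplicity of 0 is \<open>q k\<close> with \<open>k > 0\<close>. Convexity of \<open>q ^ x\<close> forces at least two
  nonzero elements in \<open>A\<close> and an element at least 3 in \<open>B\<close> (if 1 occurs there), and congruences
  modulo \<open>q\<^sup>2\<close> and \<open>q\<^sup>3\<close> restrict the multiplicities of 1 and 2 enough to bound the sum.
\<close>

section \<open>Multiplicities and divisibility in power sums\<close>

lemma sum_mset_split_count:
  fixes f :: "'a \<Rightarrow> nat"
  shows "(\<Sum>x\<in>#A. f x) = count A r * f r + (\<Sum>x\<in>#filter_mset (\<lambda>x. x \<noteq> r) A. f x)"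
  by (induction A) auto

lemma size_split_count:
  "size A = count A r + size (filter_mset (\<lambda>x. x \<noteq> r) A)"
  by (induction A) auto

lemma mult_size_le_sum_mset:
  fixes A :: "nat multiset"
  assumes "\<And>x. x \<in># A \<Longrightarrow> c \<le> x"
  shows "c * size A \<le> sum_mset A"
  using assms by (induction A) (auto, fastforce)

lemma power_dvd_sum_mset_power:
  fixes q :: nat
  assumes "\<And>x. x \<in># A \<Longrightarrow> r \<le> x"
  shows "q ^ r dvd (\<Sum>x\<in>#A. q ^ x)"
  using assms by (induction A) (auto simp: le_imp_power_dvd)

text \<open>Modulo \<open>q ^ Suc r\<close> only the copies of \<open>r\<close> in \<open>A\<close>
  survive in the equation between the power sums.\<close>

lemma dvd_count_least_exponent:
  fixes q :: nat
  assumes "q > 0"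
    and A: "\<And>x. x \<in># A \<Longrightarrow> r \<le> x" and B: "\<And>x. x \<in># B \<Longrightarrow> r < x"
    and eq: "(\<Sum>x\<in>#A. q ^ x) = (\<Sum>x\<in>#B. q ^ x)"
  shows "q dvd count A r"
proof -
  have "q ^ Suc r dvd (\<Sum>x\<in>#B. q ^ x)"
    using B by (intro power_dvd_sum_mset_power) (simp add: Suc_leI)
  moreover have "q ^ Suc r dvd (\<Sum>x\<in>#filter_mset (\<lambda>x. x \<noteq> r) A. q ^ x)"
    using A by (intro power_dvd_sum_mset_power) (auto simp: Suc_le_eq le_neq_implies_less)
  moreover have "(\<Sum>x\<in>#B. q ^ x) = count A r * q ^ r + (\<Sum>x\<in>#filter_mset (\<lambda>x. x \<noteq> r) A. q ^ x)"
    using eq sum_mset_split_count[of "\<lambda>x. q ^ x" A r] by simp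
  ultimately have "q ^ Suc r dvd count A r * q ^ r"
    by (metis dvd_add_left_iff)
  then show ?thesis using \<open>q > 0\<close> by simp
qed

text \<open>The least exponent overall lies on one side only, so its multiplicity there is a
  positive multiple of \<open>q\<close>.\<close>

lemma size_ge_of_disjoint:
  fixes q :: nat
  assumes q: "q > 0" and disj: "A \<inter># B = {#}" and ne: "A \<noteq> {#}"
    and sz: "size A = size B"
    and eq: "(\<Sum>x\<in>#A. q ^ x) = (\<Sum>x\<in>#B. q ^ x)"
  shows "q \<le> size A"
proof -
  define r where "r = Min (set_mset (A + B))"
  have r_in: "r \<in># A + B" unfolding r_def using ne by (intro Min_in) auto
  have r_le: "r \<le> x" if "x \<in># A + B" for x
    unfolding r_def using that by (intro Min_le) auto
  have main: "q \<le> size C" if "r \<in># C" "r \<notin># D" "C + D = A + B"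
    "(\<Sum>x\<in>#C. q ^ x) = (\<Sum>x\<in>#D. q ^ x)" for C D
  proof -
    have "x \<in># C \<Longrightarrow> r \<le> x" "x \<in># D \<Longrightarrow> r \<le> x" for x
      using r_le that(3) by (metis union_iff)+
    moreover have "x \<in># D \<Longrightarrow> r < x" for x
      using calculation(2)[of x] that(2) by (cases "x = r") auto
    ultimately have "q dvd count C r"
      using dvd_count_least_exponent[of q C r D] q that by blast
    then have "q \<le> count C r" using that(1) by (intro dvd_imp_le) auto
    then show ?thesis using count_le_size[of C r] by simp
  qed
  show ?thesis
  proof (cases "r \<in># A")
    case True
    then have "r \<notin># B" using disj by (metis disjunct_not_in)
    then show ?thesis using main[of A B] True eq by simp
  next
    case False
    then have "r \<in># B" using r_in by simp
    then show ?thesis using main[of B A] False eq sz by (simp add: union_commute)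
  qed
qed

section \<open>Consequences of the convexity of powers\<close>

lemma power_add_gt:
  fixes q :: nat
  assumes "q \<ge> 2" "x > 0" "y > 0"
  shows "q ^ x + q ^ y < q ^ (x + y) + 1"
proof -
  have "q ^ x > 1" "q ^ y > 1" using assms one_less_power[of q] by simp_all
  then obtain u v where "q ^ x = u + 2" "q ^ y = v + 2"
    by (metis Suc_1 Suc_leI add.commute le_Suc_ex One_nat_def)
  then show ?thesis by (simp add: power_add algebra_simps)
qed

text \<open>The right side is one more than the power sum when a single element carries the whole
  sum and the others are 0; merging elements one at a time reaches this extreme.\<close>

lemma sum_mset_power_le:
  fixes q :: nat
  assumes "q \<ge> 2"
  shows "(\<Sum>x\<in>#B. q ^ x) + 1 \<le> q ^ sum_mset B + size B"
proof (induction B)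
  case (add x B)
  have "q ^ x + q ^ sum_mset B \<le> q ^ (x + sum_mset B) + 1"
    using power_add_gt[OF assms, of x "sum_mset B"]
    by (cases "x = 0"; cases "sum_mset B = 0") (simp_all del: sum_mset_0_iff)
  then show ?case using add by simp
qed simp

text \<open>With at most one nonzero element, \<open>A\<close> would be the extreme distribution.
  \<open>B\<close> has at least two elements, all positive, so its power sum would be strictly
  smaller.\<close>

lemma two_le_size_nonzero:
  fixes q :: nat
  assumes q: "q \<ge> 2" and sz: "size A = size B" "size B \<ge> 2" and sm: "sum_mset A = sum_mset B"
    and eq: "(\<Sum>x\<in>#A. q ^ x) = (\<Sum>x\<in>#B. q ^ x)"
    and B: "\<And>x. x \<in># B \<Longrightarrow> x > 0"
  shows "size (filter_mset (\<lambda>x. x \<noteq> 0) A) \<ge> 2"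
proof (rule ccontr)
  let ?A = "filter_mset (\<lambda>x. x \<noteq> 0) A"
  assume "\<not> ?thesis"
  then consider "?A = {#}" | v where "?A = {#v#}"
    by (metis One_nat_def less_2_cases_iff not_le size_1_singleton_mset size_eq_0_iff_empty)
  then show False
  proof cases
    case 1
    then have "sum_mset A = 0" using sum_mset_split_count[of id A 0] by simp
    moreover have "sum_mset B \<ge> 1 * size B"
      using B by (intro mult_size_le_sum_mset) (simp add: Suc_leI)
    ultimately show False using sm sz by linarith
  next
    case 2
    have v: "sum_mset B = v" using sum_mset_split_count[of id A 0] 2 sm by simp
    have szB: "size B = count A 0 + 1" using size_split_count[of A 0] 2 sz by simp
    have pw: "(\<Sum>x\<in>#B. q ^ x) = count A 0 + q ^ v"
      using sum_mset_split_count[of "\<lambda>x. q ^ x" A 0] 2 eq by simp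
    obtain x C where C: "B = add_mset x C" using sz by (cases B) auto
    have "1 * size C \<le> sum_mset C"
      using B C by (intro mult_size_le_sum_mset) (simp add: Suc_leI)
    then have "sum_mset C > 0" using sz C by simp
    then have "q ^ x + q ^ sum_mset C < q ^ v + 1"
      using power_add_gt[OF q, of x "sum_mset C"] B[of x] C v by simp
    then show False using sum_mset_power_le[OF q, of C] C pw szB by simp
  qed
qed

text \<open>The function \<open>q ^ x - (q\<^sup>2 - q) x + (q\<^sup>2 - 2 q)\<close> vanishes at 1 and 2, hence is nonnegative on
  the integers by convexity, and it is positive at 0.\<close>

lemma power_ge_secant:
  fixes q x :: nat
  assumes "q \<ge> 2"
  shows "int q ^ x \<ge> (int q ^ 2 - int q) * int x - (int q ^ 2 - 2 * int q)"
proof (induction x rule: less_induct)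
  case (less x)
  consider "x = 0" | "x = 1" | "x = 2" | y where "x = Suc y" "y \<ge> 2"
    by (metis One_nat_def Suc_1 le_less not_less_eq_eq not0_implies_Suc le_0_eq)
  then show ?case
  proof cases
    case 4
    \<comment> \<open>The increment \<open>(q - 1) * q ^ y\<close> of the power is at least the
      slope \<open>(q - 1) * q\<close> of the secant.\<close>
    have "int q ^ 2 \<le> int q ^ y" using assms 4 by (intro power_increasing) auto
    then have "(int q - 1) * int q ^ 2 \<le> (int q - 1) * int q ^ y"
      using assms by (intro mult_left_mono) auto
    moreover have "(int q - 1) * int q \<le> (int q - 1) * int q ^ 2"
      using assms by (intro mult_left_mono) (auto simp: power2_eq_square)
    ultimately have "(int q - 1) * int q \<le> (int q - 1) * int q ^ y" by linarith
    then show ?thesis using less[of y] 4 by (simp add: algebra_simps power2_eq_square)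
  next
    case 1
    have "0 \<le> (int q - 1) ^ 2" by simp
    then show ?thesis using 1 by (simp add: power2_eq_square algebra_simps)
  qed (simp_all add: algebra_simps power2_eq_square)
qed

text \<open>The total gap to the secant through 1 and 2 depends only on size, sum and power sum. It
  would be zero for a \<open>B\<close> made of 1s and 2s, but a 0 in \<open>A\<close> contributes
  \<open>(q - 1) ^ 2\<close>.\<close>

lemma exists_ge_three:
  fixes q :: nat
  assumes q: "q \<ge> 2" and sz: "size A = size B" and sm: "sum_mset A = sum_mset B"
    and eq: "(\<Sum>x\<in>#A. q ^ x) = (\<Sum>x\<in>#B. q ^ x)"
    and B: "\<And>x. x \<in># B \<Longrightarrow> x > 0" and A: "0 \<in># A"
  shows "\<exists>x\<in>#B. x \<ge> 3"
proof (rule ccontr)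
  assume "\<not> ?thesis"
  then have B12: "x = 1 \<or> x = 2" if "x \<in># B" for x
    using B[OF that] that by (metis One_nat_def Suc_1 less_Suc_eq not_le numeral_3_eq_3 not_less_zero less_numeral_extra(3))
  let ?s = "\<lambda>x::nat. int q ^ x - (int q ^ 2 - int q) * int x + (int q ^ 2 - 2 * int q)"
  have lin: "(\<Sum>x\<in>#M. ?s x) = int (\<Sum>x\<in>#M. q ^ x) - (int q ^ 2 - int q) * int (sum_mset M)
      + (int q ^ 2 - 2 * int q) * int (size M)" for M
    by (induction M) (auto simp: algebra_simps)
  have nonneg: "0 \<le> (\<Sum>x\<in>#M. ?s x)" for M
  proof (induction M)
    case (add x M)
    then show ?case using power_ge_secant[OF q, of x] by simp
  qed simp
  have "(\<Sum>x\<in>#M. ?s x) = 0" if "\<And>x. x \<in># M \<Longrightarrow> x = 1 \<or> x = 2" for M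
    using that
  proof (induction M)
    case (add x M)
    have "?s x = 0" using add.prems[of x] by (auto simp: power2_eq_square algebra_simps)
    moreover have "(\<Sum>x\<in>#M. ?s x) = 0" using add by simp
    ultimately show ?case by simp
  qed simp
  then have "(\<Sum>x\<in>#A. ?s x) = 0" using lin[of A] lin[of B] sz sm eq B12 by simp
  moreover obtain C where "A = add_mset 0 C" using A by (metis multi_member_split)
  ultimately have "?s 0 + (\<Sum>x\<in>#C. ?s x) = 0" by simp
  then have "?s 0 \<le> 0" using nonneg[of C] by linarith
  then have "(int q - 1) ^ 2 \<le> 0" by (simp add: power2_eq_square algebra_simps)
  then show False using q by simp
qed

section \<open>The lower bound for the sum of the exponents\<close>

lemma sum_exponents_ge_aux:
  fixes q :: nat
  assumes q: "q \<ge> 2" and sz: "size A = size B" and sm: "sum_mset A = sum_mset B"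
    and eq: "(\<Sum>x\<in>#A. q ^ x) = (\<Sum>x\<in>#B. q ^ x)"
    and disj: "A \<inter># B = {#}" and A: "0 \<in># A"
  shows "2 * q + 4 \<le> sum_mset A"
proof -
  have disj': "x \<notin># A \<or> x \<notin># B" for x using disj by (metis disjunct_not_in)
  have B: "x > 0" if "x \<in># B" for x using disj'[of 0] A that by (cases x) auto
  have "q dvd count A 0"
    using dvd_count_least_exponent[of q A 0 B] q B eq by simp
  then obtain k where k: "count A 0 = q * k" by blast
  have k0: "k \<ge> 1" using A k by (cases k) (auto simp flip: count_greater_zero_iff)
  then have qk: "q * k \<ge> q" by simp
  define A1 where "A1 = filter_mset (\<lambda>x. x \<noteq> 0) A"
  have szA: "size A = q * k + size A1" using size_split_count[of A 0] k A1_def by simp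
  have t2: "size A1 \<ge> 2"
    unfolding A1_def using two_le_size_nonzero[OF q sz _ sm eq B] szA qk sz q by simp
  show ?thesis
  proof (cases "1 \<in># B")
    case False
    \<comment> \<open>All elements of \<open>B\<close> are at least 2, and there are at least
      \<open>q + 2\<close> of them.\<close>
    then have "2 * size B \<le> sum_mset B"
      using B by (intro mult_size_le_sum_mset)
        (metis One_nat_def Suc_1 Suc_leI le_neq_implies_less)
    then show ?thesis using szA sz sm t2 qk by linarith
  next
    case True
    \<comment> \<open>Since 1 is in \<open>B\<close>, it is not in \<open>A\<close>. So
      \<open>A\<close> consists of 0s, 2s and \<open>A3\<close>, and \<open>B\<close> of 1s, 2s and
      \<open>B3\<close>.\<close>
    define B1 where "B1 = filter_mset (\<lambda>x. x \<noteq> 1) B"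
    define A3 where "A3 = filter_mset (\<lambda>x. x \<noteq> 2) A1"
    define B3 where "B3 = filter_mset (\<lambda>x. x \<noteq> 2) B1"
    define a2 where "a2 = count A1 2"
    define b1 where "b1 = count B 1"
    define b2 where "b2 = count B1 2"
    have b1: "b1 \<ge> 1" unfolding b1_def using True by (simp add: Suc_le_eq)
    have A3_ge: "x \<ge> 3" if "x \<in># A3" for x
    proof -
      have "x \<in># A" "x \<noteq> 0" "x \<noteq> 2" using that by (auto simp: A3_def A1_def)
      moreover have "x \<noteq> 1" using disj'[of x] True \<open>x \<in># A\<close> by auto
      ultimately show ?thesis by simp
    qed
    have B3_ge: "x \<ge> 3" if "x \<in># B3" for x
    proof -
      have "x \<in># B" "x \<noteq> 1" "x \<noteq> 2" using that by (auto simp: B3_def B1_def)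
      then show ?thesis using B[of x] by simp
    qed
    obtain w where "w \<in># B" "w \<ge> 3" using exists_ge_three[OF q sz sm eq B A] by blast
    then have "w \<in># B3" by (auto simp: B3_def B1_def)
    then have B3_1: "size B3 \<ge> 1" by (cases B3) auto
    have szA1: "size A1 = a2 + size A3"
      using size_split_count[of A1 2] by (simp add: a2_def A3_def)
    have szB: "q * k + size A1 = b1 + b2 + size B3"
      using size_split_count[of B 1] size_split_count[of B1 2] sz szA
      by (simp add: b1_def B1_def B3_def b2_def)
    have sumA: "sum_mset A = 2 * a2 + sum_mset A3"
      using sum_mset_split_count[of id A 0] sum_mset_split_count[of id A1 2]
      by (simp add: A1_def A3_def a2_def)
    have sumB: "sum_mset A = b1 + 2 * b2 + sum_mset B3"
      using sum_mset_split_count[of id B 1] sum_mset_split_count[of id B1 2] sm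
      by (simp add: B1_def B3_def b1_def b2_def)
    have sumA3: "3 * size A3 \<le> sum_mset A3" by (intro mult_size_le_sum_mset A3_ge)
    have sumB3: "3 * size B3 \<le> sum_mset B3" by (intro mult_size_le_sum_mset B3_ge)
    obtain U where U: "(\<Sum>x\<in>#A3. q ^ x) = q ^ 3 * U"
      using power_dvd_sum_mset_power[OF A3_ge] by blast
    obtain V where V: "(\<Sum>x\<in>#B3. q ^ x) = q ^ 3 * V"
      using power_dvd_sum_mset_power[OF B3_ge] by blast
    have "q * k + a2 * q ^ 2 + q ^ 3 * U = b1 * q + b2 * q ^ 2 + q ^ 3 * V"
      using eq U V sum_mset_split_count[of "\<lambda>x. q ^ x" A 0] sum_mset_split_count[of "\<lambda>x. q ^ x" A1 2]
        sum_mset_split_count[of "\<lambda>x. q ^ x" B 1] sum_mset_split_count[of "\<lambda>x. q ^ x" B1 2] k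
      by (simp add: A1_def A3_def B1_def B3_def a2_def b1_def b2_def)
    \<comment> \<open>Elements from 3 on contribute multiples of \<open>q ^ 3\<close>, so dividing
      by \<open>q\<close> here, and once more in \<open>mod3\<close>, leaves relations between the
      small multiplicities.\<close>
    then have "q * (k + q * (a2 + q * U)) = q * (b1 + q * (b2 + q * V))"
      by (simp add: algebra_simps power2_eq_square power3_eq_cube)
    then have mod2: "k + q * (a2 + q * U) = b1 + q * (b2 + q * V)" using q by simp
    have a2b2: "a2 = 0 \<or> b2 = 0"
      using disj'[of 2] by (auto simp: a2_def b2_def A1_def B1_def not_in_iff)
    show ?thesis
    proof (cases "k \<ge> 2")
      case True
      \<comment> \<open>\<open>B\<close> has at least \<open>2 * q + 2\<close> positive elements,
        and one of them, being at least 3, adds 2 more.\<close>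
      then have "q * k \<ge> q * 2" by (intro mult_le_mono2)
      then show ?thesis using sumB sumB3 szB t2 B3_1 by linarith
    next
      case False
      then have k1: "k = 1" using k0 by simp
      have "1 mod q = b1 mod q"
        using mod2 k1 by (metis mod_mult_self2)
      then obtain e where e: "b1 = 1 + q * e"
        using q by (metis mod_less mult_div_mod_eq one_less_numeral_iff order_less_le_trans semiring_norm(76) add.commute)
      have "q * (a2 + q * U) = q * (e + b2 + q * V)"
        using mod2 k1 e by (simp add: algebra_simps)
      then have mod3: "a2 + q * U = e + b2 + q * V" using q by simp
      consider "e = 0" | "e = 1" | "e \<ge> 2" by linarith
      then show ?thesis
      proof cases
        case 1
        \<comment> \<open>Only one element of \<open>B\<close> is 1; at least \<open>q + 1\<close>
          others are at least 2, and one of these is at least 3.\<close>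
        then show ?thesis using e szB sumB sumB3 B3_1 t2 k1 by simp
      next
        case 3
        \<comment> \<open>So many 1s in \<open>B\<close> force \<open>size A1\<close> to be at least
          \<open>q + 2\<close>, and the elements of \<open>A1\<close> are at least 2.\<close>
        then have "q * e \<ge> q * 2" by (intro mult_le_mono2)
        moreover have "q + size A1 = 1 + q * e + b2 + size B3" using szB k1 e by simp
        ultimately show ?thesis using B3_1 szA1 sumA sumA3 by linarith
      next
        case 2
        \<comment> \<open>This suffices: \<open>B\<close> has \<open>q + 1\<close> ones and
          \<open>size A1 - 1\<close> larger elements, one of them at least 3, so its sum is at least
          \<open>3 * q + 2\<close>, and \<open>q\<close> is at least 2.\<close>
        have "size A1 \<ge> q + 1"
        proof (cases "a2 = 0")
          case True
          then have "q dvd 1 + b2 + q * V"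
            using mod3 2 by (metis add_0 dvd_triv_left)
          then have "q dvd 1 + b2" by (metis dvd_add_left_iff dvd_triv_left)
          then have "q \<le> 1 + b2" by (rule dvd_imp_le) simp
          then show ?thesis using szB e 2 k1 B3_1 by simp
        next
          case False
          then have b20: "b2 = 0" using a2b2 by simp
          consider "U = V" | "U < V" | "V < U" by linarith
          then show ?thesis
          proof cases
            case 1
            \<comment> \<open>Here \<open>A3\<close> and \<open>B3\<close> have equal power sums,
              and \<open>a2 = 1\<close> makes their sizes agree, so the bound for disjoint multisets
              applies to them.\<close>
            have a21: "a2 = 1" using mod3 2 1 b20 by simp
            have "A3 \<inter># B3 = {#}"
              using disj' by (auto simp: A3_def B3_def A1_def B1_def disjunct_not_in)
            moreover have sz3: "size A3 = size B3" using szA1 szB a21 b20 e 2 k1 by simp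
            moreover have "A3 \<noteq> {#}" using sz3 B3_1 by auto
            ultimately have "q \<le> size A3"
              using size_ge_of_disjoint[of q A3 B3] q U V 1 by simp
            then show ?thesis using szA1 a21 by simp
          next
            case 2
            then have "q * Suc U \<le> q * V" by (intro mult_le_mono2) simp
            then show ?thesis using mod3 \<open>e = 1\<close> b20 szA1 by simp
          next
            case 3
            then have "q * Suc V \<le> q * U" by (intro mult_le_mono2) simp
            then show ?thesis using mod3 \<open>e = 1\<close> b20 False q by simp
          qed
        qed
        then show ?thesis using e 2 szB sumB sumB3 B3_1 k1 q by simp
      qed
    qed
  qed
qed

text \<open>Removing a common element, or lowering all exponents by 1 when 0 is absent, preserves
  the equalities and decreases \<open>size A + sum_mset A\<close>. What remains is the disjoint case
  with a 0 on one side.\<close>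

lemma sum_exponents_ge:
  fixes q :: nat
  assumes q: "q \<ge> 2" and sz: "size A = size B" and sm: "sum_mset A = sum_mset B"
    and eq: "(\<Sum>x\<in>#A. q ^ x) = (\<Sum>x\<in>#B. q ^ x)" and ne: "A \<noteq> B"
  shows "2 * q + 4 \<le> sum_mset A"
  using sz sm eq ne
proof (induction "size A + sum_mset A" arbitrary: A B rule: less_induct)
  case less
  show ?case
  proof (cases "A \<inter># B = {#}")
    case False
    then obtain x where "x \<in># A" "x \<in># B" by (auto simp: disjunct_not_in)
    then obtain C D where CD: "A = add_mset x C" "B = add_mset x D"
      by (metis multi_member_split)
    then have "2 * q + 4 \<le> sum_mset C"
      using less.prems less.hyps[of C D] by simp
    then show ?thesis using CD by simp
  next
    case disj: True
    consider "0 \<in># A" | "0 \<in># B" | "0 \<notin># A" "0 \<notin># B" by blast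
    then show ?thesis
    proof cases
      case 1
      then show ?thesis using sum_exponents_ge_aux[OF q] less.prems disj by blast
    next
      case 2
      moreover have "B \<inter># A = {#}" using disj by (auto simp: disjunct_not_in)
      ultimately show ?thesis
        using sum_exponents_ge_aux[OF q, of B A] less.prems by simp
    next
      case 3
      have ex: "\<exists>C. M = image_mset Suc C" if "0 \<notin># M" for M :: "nat multiset"
      proof
        show "M = image_mset Suc (image_mset (\<lambda>x. x - 1) M)"
          using that by (induction M) auto
      qed
      obtain C D where C: "A = image_mset Suc C" and D: "B = image_mset Suc D"
        using ex 3 by metis
      have sum_Suc: "sum_mset (image_mset Suc M) = sum_mset M + size M" for M
        by (induction M) auto
      have pow_Suc: "(\<Sum>x\<in>#image_mset Suc M. q ^ x) = q * (\<Sum>x\<in>#M. q ^ x)" for M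
        by (induction M) (auto simp: algebra_simps)
      have "A \<noteq> {#}" using less.prems by auto
      then have "size C > 0" using C by (simp add: nonempty_has_size)
      moreover have "q * (\<Sum>x\<in>#C. q ^ x) = q * (\<Sum>x\<in>#D. q ^ x)"
        using less.prems(3) C D pow_Suc by metis
      then have "(\<Sum>x\<in>#C. q ^ x) = (\<Sum>x\<in>#D. q ^ x)" using q by simp
      moreover have "size C = size D" "sum_mset C = sum_mset D" "C \<noteq> D"
        using less.prems C D sum_Suc by auto
      ultimately have "2 * q + 4 \<le> sum_mset C"
        using less.hyps[of C D] C sum_Suc by simp
      then show ?thesis using C sum_Suc by simp
    qed
  qed
qed

section \<open>Passing between factors and exponents; the construction\<close>

lemma prod_mset_power: "(\<Prod>x\<in>#A. q ^ x) = (q::nat) ^ sum_mset A"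
  by (induction A) (auto simp: power_add)

lemma prod_mset_eq_prime_powerE:
  fixes q :: nat
  assumes "prime q" "prod_mset X = q ^ j"
  obtains A where "X = image_mset (\<lambda>a. q ^ a) A" "sum_mset A = j"
proof -
  have "\<exists>A. X = image_mset (\<lambda>a. q ^ a) A"
  proof -
    have "\<exists>a. x = q ^ a" if "x \<in># X" for x
      using dvd_prod_mset[OF that] assms divides_primepow_nat by metis
    then show ?thesis
    proof (induction X)
      case (add x X)
      then obtain a A where "x = q ^ a" "X = image_mset (\<lambda>a. q ^ a) A" by fastforce
      then have "add_mset x X = image_mset (\<lambda>a. q ^ a) (add_mset a A)" by simp
      then show ?case by blast
    qed simp
  qed
  then obtain A where A: "X = image_mset (\<lambda>a. q ^ a) A" by blast
  then have "q ^ sum_mset A = q ^ j" using assms prod_mset_power by metis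
  then have "sum_mset A = j"
    using prime_gt_1_nat[OF assms(1)] by (simp add: power_inject_exp)
  then show ?thesis using that A by blast
qed

lemma product_admissible_prime_powerD:
  assumes "prime q" "product_admissible (q ^ j)"
  shows "2 * q + 4 \<le> j"
proof -
  obtain X Y where XY: "X \<noteq> Y" "size X = size Y" "sum_mset X = sum_mset Y"
    "prod_mset X = q ^ j" "prod_mset Y = q ^ j"
    using assms(2) unfolding product_admissible_def admissible_def T_def by auto
  obtain A where A: "X = image_mset (\<lambda>a. q ^ a) A" "sum_mset A = j"
    using prod_mset_eq_prime_powerE[OF assms(1) XY(4)] .
  obtain B where B: "Y = image_mset (\<lambda>a. q ^ a) B" "sum_mset B = j"
    using prod_mset_eq_prime_powerE[OF assms(1) XY(5)] .
  show ?thesis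
    using sum_exponents_ge[of q A B] prime_ge_2_nat[OF assms(1)] XY A B by auto
qed

text \<open>The coefficients of \<open>(x - 1)^2 (x - q)\<close>, separated by sign, are the
  multiplicities of the exponents in \<open>X\<close> and \<open>Y\<close>.\<close>

lemma product_admissible_powerI:
  assumes q: "q \<ge> 2" and j: "2 * q + 4 \<le> j"
  shows "product_admissible (q ^ j)"
proof -
  define X where "X = add_mset (q ^ 3) (replicate_mset (2 * q + 1) q)"
  define Y where "Y = replicate_mset (q + 2) (q ^ 2) + replicate_mset q 1"
  \<comment> \<open>A common extra element changes both triples alike; this one raises the exponent
    of the product from \<open>2 * q + 4\<close> to \<open>j\<close>.\<close>
  define z where "z = q ^ (j - (2 * q + 4))"
  have z: "z > 0" using q by (simp add: z_def)
  have zj: "q ^ (2 * q + 4) * z = q ^ j" using j by (simp add: z_def flip: power_add)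
  have "1 < q ^ 3" using q by (intro one_less_power) auto
  then have "1 \<notin># X" "1 \<in># Y" using q by (auto simp: X_def Y_def)
  then have "X \<noteq> Y" by metis
  have pos: "\<forall>x\<in>#add_mset z X. x > 0" "\<forall>y\<in>#add_mset z Y. y > 0"
    using z q by (auto simp: X_def Y_def)
  have size: "size X = 2 * q + 2" "size Y = 2 * q + 2" by (simp_all add: X_def Y_def)
  have sum: "sum_mset X = sum_mset Y"
    by (simp add: X_def Y_def algebra_simps power2_eq_square power3_eq_cube)
  have "prod_mset X = q ^ (3 + (2 * q + 1))"
    unfolding X_def power_add by simp
  moreover have "prod_mset Y = q ^ (2 * (q + 2))"
    unfolding Y_def power_mult by simp
  moreover have "3 + (2 * q + 1) = 2 * q + 4" "2 * (q + 2) = 2 * q + 4" by simp_all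
  ultimately have prod: "prod_mset X = q ^ (2 * q + 4)" "prod_mset Y = q ^ (2 * q + 4)"
    by metis+
  have TX: "T (add_mset z X) = (z + sum_mset X, q ^ j, 2 * q + 3)"
    using zj prod size by (simp add: T_def mult.commute)
  have TY: "T (add_mset z Y) = (z + sum_mset X, q ^ j, 2 * q + 3)"
    using zj prod size sum by (simp add: T_def mult.commute)
  have "admissible (z + sum_mset X) (q ^ j) (2 * q + 3)"
    unfolding admissible_def
    using z q pos TX TY size \<open>X \<noteq> Y\<close>
    by (intro conjI exI[of _ "add_mset z X"] exI[of _ "add_mset z Y"]) auto
  then show ?thesis
    unfolding product_admissible_def using z q
    by (intro conjI exI[of _ "z + sum_mset X"] exI[of _ "2 * q + 3"]) auto
qed

theorem theorem3p2:
  fixes q j :: nat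
  assumes "prime q" and "j > 0"
  shows "product_admissible (q ^ j) \<longleftrightarrow> j \<ge> 2 * q + 4"
  using product_admissible_prime_powerD product_admissible_powerI prime_ge_2_nat assms(1)
  by blast

end
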